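(* Let $\ell\ge m\ge n>0$ and let $\mathcal{A}=\sum_{i=1}^r\alpha_i\otimes\beta_i\otimes\gamma_i\in\mathbb{C}^{\ell+1}\otimes\mathbb{C}^{m+1}\otimes\mathbb{C}^{n+1}$ be a tensor of rank $r\le\min\{\ell+1,mn\}$ that is generic in the sense of the context. Let $f_1,\dots,f_s\in S_{(1,1)}$ be a basis of $\ker\mathcal{A}_{(1)}$ and $I=\langle f_1,\dots,f_s\rangle\subset S$. If $(d,e)\in\mathbb{N}^2$, $(d,e)\ge(1,1)$, is such that $\mathrm{HF}_{S/I}(d,e)=r$, then any left nullspace matrix $N$ of $R_I(d,e)$ (a matrix whose rows form a basis of the left null space of $R_I(d,e)$) represents a pre-normal form on $S_{(d,e)}$, i.e., a linear map $N:S_{(d,e)}\to\mathbb{C}^r$ with $\operatorname{rank}(N)=r$ and $\ker N=I_{(d,e)}$.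
   Context: $S=\mathbb{C}[x_0,\dots,x_m,y_0,\dots,y_n]=\bigoplus_{(d,e)\in\mathbb{N}^2}S_{(d,e)}$, with $S_{(d,e)}$ spanned by monomials of degree $d$ in $x$ and $e$ in $y$; tuples are compared entrywise. $I_{(d,e)}=I\cap S_{(d,e)}$, $\mathrm{HF}_S(d,e)=\dim_{\mathbb{C}}S_{(d,e)}$, $\mathrm{HF}_{S/I}(d,e)=\dim_{\mathbb{C}}S_{(d,e)}/I_{(d,e)}$, and $V_X(I)$ is the zero set of $I$ in $X=\mathbb{P}^m\times\mathbb{P}^n$. The flattening $\mathcal{A}_{(1)}=\sum_i\alpha_i(\beta_i\otimes\gamma_i)^\top$ is viewed as a linear map $S_{(1,1)}\to\mathbb{C}^{\ell+1}$ by identifying $e_k\otimes e_l$ with $x_ky_l$. For $(d,e)\ge(1,1)$, $R_I(d,e)\in\mathbb{C}^{\mathrm{HF}_S(d,e)\times s\,\mathrm{HF}_S(d-1,e-1)}$ is the matrix whose rows are indexed by the monomials $x^ay^b$ with $|a|=d$, $|b|=e$, and whose columns are the coefficient vectors, in this monomial basis, of the polynomials $x^{a'}y^{b'}f_i$ with $|a'|=d-1$, $|b'|=e-1$, $i=1,\dots,s$. A matrix with $\mathrm{HF}_S(d,e)$ columns represents a linear map on $S_{(d,e)}$ with respect to the monomial basis. Generic means: (i) $\mathcal{A}$ is $r$-identifiable (there is exactly one set of $r$ rank-1 tensors with sum $\mathcal{A}$); (ii) $\mathcal{A}_{(1)}$ has rank $r$; (iii) $V_X(I)=\{(\beta_i,\gamma_i)\}_{i=1}^r$,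 and these are $r$ points of multiplicity one (the subscheme of $X$ defined by $I$ is reduced at each of them). *)

theory Defs
  imports
    "HOL-Analysis.Analysis"
    "HOL-Library.Poly_Mapping"
    "Jordan_Normal_Form.Matrix_Kernel"
    "Jordan_Normal_Form.DL_Rank"
begin

text \<open>Tensors, their flattenings and the points of projective space use the vectors \<open>complex ^ 'n\<close>
  of \<open>HOL-Analysis\<close>. Matrices whose size depends on a bidegree are those of \<open>Jordan_Normal_Form\<close>.\<close>

no_notation Matrix.vec_index (infixl "$" 100)


section \<open>Tensors\<close>

type_synonym ('l, 'm, 'n) tensor = "((complex ^ 'n) ^ 'm) ^ 'l"

definition tprod ::
  "complex ^ 'l \<Rightarrow> complex ^ 'm \<Rightarrow> complex ^ 'n \<Rightarrow> ('l, 'm, 'n) tensor" where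
  "tprod a b c = (\<chi> j k l. a $ j * b $ k * c $ l)"

definition rank_one :: "('l::finite, 'm::finite, 'n::finite) tensor \<Rightarrow> bool" where
  "rank_one T \<longleftrightarrow> (\<exists>a b c. a \<noteq> 0 \<and> b \<noteq> 0 \<and> c \<noteq> 0 \<and> T = tprod a b c)"

definition tensor_rank :: "('l::finite, 'm::finite, 'n::finite) tensor \<Rightarrow> nat" where
  "tensor_rank A = (LEAST k. \<exists>T :: nat \<Rightarrow> ('l, 'm, 'n) tensor.
     (\<forall>i<k. rank_one (T i)) \<and> A = (\<Sum>i<k. T i))"

definition identifiable :: "nat \<Rightarrow> ('l::finite, 'm::finite, 'n::finite) tensor \<Rightarrow> bool" where
  "identifiable r A \<longleftrightarrow> (\<exists>!\<T>. finite \<T> \<and> card \<T> = r \<and> (\<forall>T\<in>\<T>. rank_one T) \<and> \<Sum>\<T> = A)"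

definition flattening ::
  "('l::finite, 'm::finite, 'n::finite) tensor \<Rightarrow> complex ^ ('m \<times> 'n) ^ 'l" where
  "flattening A = (\<chi> j p. A $ j $ fst p $ snd p)"

definition kron :: "complex ^ 'm \<Rightarrow> complex ^ 'n \<Rightarrow> complex ^ ('m \<times> 'n)" where
  "kron b c = (\<chi> p. b $ fst p * c $ snd p)"

lemma flattening_sum_tprod:
  "flattening (\<Sum>i\<in>X. tprod (\<alpha> i) (\<beta> i) (\<gamma> i)) =
     (\<Sum>i\<in>X. \<chi> j p. \<alpha> i $ j * kron (\<beta> i) (\<gamma> i) $ p)"
  by (simp add: Finite_Cartesian_Product.vec_eq_iff flattening_def tprod_def kron_def mult.assoc)


section \<open>The bigraded polynomial ring\<close>

text \<open>The variable \<open>Inl k\<close> is $x_k$ and the variable \<open>Inr l\<close> is $y_l$, so that the type below is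
  the whole ring $S$ with \<open>CARD('m)\<close> variables $x$ and \<open>CARD('n)\<close> variables $y$.\<close>

type_synonym ('m, 'n) bimon = "('m + 'n) \<Rightarrow>\<^sub>0 nat"
type_synonym ('m, 'n) bipoly = "('m, 'n) bimon \<Rightarrow>\<^sub>0 complex"

definition bimonom :: "('m, 'n) bimon \<Rightarrow> ('m, 'n) bipoly" where
  "bimonom a = Poly_Mapping.single a 1"

definition pscale :: "complex \<Rightarrow> ('m, 'n) bipoly \<Rightarrow> ('m, 'n) bipoly" where
  "pscale c f = Poly_Mapping.single 0 c * f"

interpretation cpoly: vector_space pscale
  by unfold_locales (simp_all add: pscale_def algebra_simps single_add mult_single flip: mult.assoc)

interpretation ring_mult: Modules.module "(*) :: 'a::comm_ring_1 \<Rightarrow> 'a \<Rightarrow> 'a"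
  by unfold_locales (simp_all add: algebra_simps)

abbreviation ideal_gen :: "'a::comm_ring_1 set \<Rightarrow> 'a set" where
  "ideal_gen F \<equiv> ring_mult.span F"

definition bimons :: "nat \<Rightarrow> nat \<Rightarrow> ('m::finite, 'n::finite) bimon set" where
  "bimons d e = {a. (\<Sum>k\<in>UNIV. Poly_Mapping.lookup a (Inl k)) = d \<and>
                    (\<Sum>l\<in>UNIV. Poly_Mapping.lookup a (Inr l)) = e}"

definition Sgr :: "nat \<Rightarrow> nat \<Rightarrow> ('m::finite, 'n::finite) bipoly set" where
  "Sgr d e = cpoly.span (bimonom ` bimons d e)"

definition eval ::
  "('m::finite, 'n::finite) bipoly \<Rightarrow> complex ^ 'm \<Rightarrow> complex ^ 'n \<Rightarrow> complex" where
  "eval f x y = (\<Sum>a\<in>Poly_Mapping.keys f. Poly_Mapping.lookup f a *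
     (\<Prod>k\<in>UNIV. x $ k ^ Poly_Mapping.lookup a (Inl k)) *
     (\<Prod>l\<in>UNIV. y $ l ^ Poly_Mapping.lookup a (Inr l)))"

text \<open>A set \<open>B\<close> of representatives of a basis of the quotient space \<open>V / W\<close>.\<close>

definition quot_basis ::
  "('m, 'n) bipoly set \<Rightarrow> ('m, 'n) bipoly set \<Rightarrow> ('m, 'n) bipoly set \<Rightarrow> bool" where
  "quot_basis V W B \<longleftrightarrow> B \<subseteq> V \<and>
     (\<forall>T c. finite T \<and> T \<subseteq> B \<and> (\<Sum>b\<in>T. pscale (c b) b) \<in> W \<longrightarrow> (\<forall>b\<in>T. c b = 0)) \<and>
     (\<forall>v\<in>V. \<exists>u\<in>cpoly.span B. v - u \<in> W)"

definition quot_dim :: "('m, 'n) bipoly set \<Rightarrow> ('m, 'n) bipoly set \<Rightarrow> nat" where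
  "quot_dim V W = card (SOME B. quot_basis V W B)"

definition HF_quot :: "('m::finite, 'n::finite) bipoly set \<Rightarrow> nat \<Rightarrow> nat \<Rightarrow> nat" where
  "HF_quot I d e = quot_dim (Sgr d e) (I \<inter> Sgr d e)"


section \<open>The flattening as a linear map on bilinear forms\<close>

definition xy :: "'m \<Rightarrow> 'n \<Rightarrow> ('m, 'n) bimon" where
  "xy k l = Poly_Mapping.single (Inl k) 1 + Poly_Mapping.single (Inr l) 1"

definition flattening_map ::
  "('l::finite, 'm::finite, 'n::finite) tensor \<Rightarrow> ('m, 'n) bipoly \<Rightarrow> complex ^ 'l" where
  "flattening_map A f = flattening A *v (\<chi> p. Poly_Mapping.lookup f (xy (fst p) (snd p)))"

definition ker_flattening ::
  "('l::finite, 'm::finite, 'n::finite) tensor \<Rightarrow> ('m, 'n) bipoly set" where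
  "ker_flattening A = {f \<in> Sgr 1 1. flattening_map A f = 0}"


section \<open>Zero sets in the product of two projective spaces\<close>

text \<open>A point of projective space is the set of all its homogeneous coordinate vectors.\<close>

definition proj_point :: "complex ^ 'm \<Rightarrow> (complex ^ 'm) set" where
  "proj_point v = {c *s v | c. c \<noteq> 0}"

type_synonym ('m, 'n) point = "(complex ^ 'm) set \<times> (complex ^ 'n) set"

definition biproj :: "('m::finite, 'n::finite) point set" where
  "biproj = (proj_point ` (- {0})) \<times> (proj_point ` (- {0}))"

definition zero_set :: "('m::finite, 'n::finite) bipoly set \<Rightarrow> ('m, 'n) point set" where
  "zero_set I = {(p, q) \<in> biproj. \<forall>f\<in>I. \<forall>x\<in>p. \<forall>y\<in>q. eval f x y = 0}"


section \<open>Reducedness of the subscheme defined by a bihomogeneous ideal\<close>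

text \<open>The local ring at the point \<open>P\<close> of the subscheme of $\mathbb{P}^m \times \mathbb{P}^n$ defined by \<open>I\<close>
  is the part of bidegree $(0,0)$ of the localization of $S/I$ at the bihomogeneous elements
  that do not vanish at \<open>P\<close>. A fraction $g/h$ is represented by the pair \<open>(g, h)\<close>.\<close>

definition nonvanishing :: "('m::finite, 'n::finite) point \<Rightarrow> ('m, 'n) bipoly set" where
  "nonvanishing P =
     {h. (\<exists>d e. h \<in> Sgr d e) \<and> (\<forall>x\<in>fst P. \<forall>y\<in>snd P. eval h x y \<noteq> 0)}"

definition fractions ::
  "('m::finite, 'n::finite) point \<Rightarrow> (('m, 'n) bipoly \<times> ('m, 'n) bipoly) set" where
  "fractions P = {(g, h). h \<in> nonvanishing P \<and> (\<exists>d e. g \<in> Sgr d e \<and> h \<in> Sgr d e)}"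

definition frac_eq ::
  "('m::finite, 'n::finite) bipoly set \<Rightarrow> ('m, 'n) point \<Rightarrow>
   (('m, 'n) bipoly \<times> ('m, 'n) bipoly) rel" where
  "frac_eq I P = {((g, h), (g', h')). (g, h) \<in> fractions P \<and> (g', h') \<in> fractions P \<and>
     (\<exists>u\<in>nonvanishing P. u * (g * h' - g' * h) \<in> I)}"

definition local_ring ::
  "('m::finite, 'n::finite) bipoly set \<Rightarrow> ('m, 'n) point \<Rightarrow>
   (('m, 'n) bipoly \<times> ('m, 'n) bipoly) set ring" where
  "local_ring I P = \<lparr>
     carrier = fractions P // frac_eq I P,
     mult = (\<lambda>a b. \<Union>(g, h)\<in>a. \<Union>(g', h')\<in>b. frac_eq I P `` {(g * g', h * h')}),
     one = frac_eq I P `` {(1, 1)},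
     zero = frac_eq I P `` {(0, 1)},
     add = (\<lambda>a b. \<Union>(g, h)\<in>a. \<Union>(g', h')\<in>b. frac_eq I P `` {(g * h' + g' * h, h * h')})\<rparr>"

definition reduced_ring :: "('a, 'b) ring_scheme \<Rightarrow> bool" where
  "reduced_ring R \<longleftrightarrow> (\<forall>a\<in>carrier R. \<forall>k::nat. a [^]\<^bsub>R\<^esub> k = \<zero>\<^bsub>R\<^esub> \<longrightarrow> a = \<zero>\<^bsub>R\<^esub>)"


section \<open>Resultant matrices and pre-normal forms\<close>

text \<open>A list \<open>ms\<close> enumerates the monomials that index rows or columns; its order fixes the
  monomial basis with respect to which vectors and matrices are written.\<close>

definition enumerates :: "('m::finite, 'n::finite) bimon list \<Rightarrow> nat \<Rightarrow> nat \<Rightarrow> bool" where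
  "enumerates ms d e \<longleftrightarrow> distinct ms \<and> set ms = bimons d e"

definition coeff_vec :: "('m, 'n) bimon list \<Rightarrow> ('m, 'n) bipoly \<Rightarrow> complex Matrix.vec" where
  "coeff_vec ms f = Matrix.vec_of_list (map (Poly_Mapping.lookup f) ms)"

definition R_matrix ::
  "('m, 'n) bimon list \<Rightarrow> ('m, 'n) bimon list \<Rightarrow> ('m, 'n) bipoly list \<Rightarrow> complex mat" where
  "R_matrix ms ms' fs =
     mat_of_cols (length ms) [coeff_vec ms (bimonom a * f). f \<leftarrow> fs, a \<leftarrow> ms']"

definition left_nullspace_matrix :: "complex mat \<Rightarrow> complex mat \<Rightarrow> bool" where
  "left_nullspace_matrix N M \<longleftrightarrow> dim_col N = dim_row M \<and> distinct (rows N) \<and>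
     vectorspace.basis class_ring
       (module_vec TYPE(complex) (dim_row M)\<lparr>carrier := mat_kernel (transpose_mat M)\<rparr>)
       (set (rows N))"

definition pre_normal_form ::
  "('m::finite, 'n::finite) bimon list \<Rightarrow> ('m, 'n) bipoly set \<Rightarrow> nat \<Rightarrow> nat \<Rightarrow> nat \<Rightarrow>
   complex mat \<Rightarrow> bool" where
  "pre_normal_form ms I d e r N \<longleftrightarrow>
     N \<in> carrier_mat r (cpoly.dim (Sgr d e :: ('m, 'n) bipoly set)) \<and>
     vec_space.rank r N = r \<and>
     {f \<in> Sgr d e. N *\<^sub>v coeff_vec ms f = 0\<^sub>v r} = I \<inter> Sgr d e"

end

theory Submission
  imports Defs
begin

text \<open>In bidegree \<open>(d, e)\<close> the ideal is spanned by the products \<open>x\<^sup>a y\<^sup>b f\<^sub>i\<close>, i.e. its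
  coefficient vectors form the column space of the resultant matrix. The rows of \<open>N\<close> span the annihilator of this
  space, so the kernel of \<open>N\<close> is the double annihilator, which is the space itself. As the rows are
  independent, \<open>N\<close> is onto; hence their number is the dimension of the quotient, which is \<open>r\<close>.\<close>

no_notation inner (infix "\<bullet>" 70)
notation Matrix.vec_index (infixl "$v" 100)

section \<open>Bihomogeneous polynomials\<close>

lemma lookup_pscale [simp]: "Poly_Mapping.lookup (pscale c f) a = c * Poly_Mapping.lookup f a"
proof -
  have "pscale c f = Poly_Mapping.map ((*) c) f"
    by (simp add: pscale_def mult_map_scale_conv_mult)
  then show ?thesis
    by (simp add: Poly_Mapping.map.rep_eq when_def)
qed

lemma lookup_bimonom: "Poly_Mapping.lookup (bimonom a) b = (if a = b then 1 else 0)"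
  by (simp add: bimonom_def lookup_single when_def)

lemma keys_bimonom [simp]: "Poly_Mapping.keys (bimonom a) = {a}"
  by (simp add: bimonom_def)

lemma mult_pscale_left: "pscale c f * g = pscale c (f * g)"
  unfolding pscale_def by (rule mult.assoc)

lemma bimonom_expansion:
  assumes "finite K" "Poly_Mapping.keys f \<subseteq> K"
  shows "f = (\<Sum>a\<in>K. pscale (Poly_Mapping.lookup f a) (bimonom a))"
proof (rule poly_mapping_eqI)
  fix b
  have "Poly_Mapping.lookup (\<Sum>a\<in>K. pscale (Poly_Mapping.lookup f a) (bimonom a)) b =
      (\<Sum>a\<in>K. if a = b then Poly_Mapping.lookup f a else 0)"
    by (auto simp: lookup_sum lookup_bimonom intro!: sum.cong)
  also have "\<dots> = Poly_Mapping.lookup f b"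
    using assms by (auto simp: in_keys_iff)
  finally show "Poly_Mapping.lookup f b =
      Poly_Mapping.lookup (\<Sum>a\<in>K. pscale (Poly_Mapping.lookup f a) (bimonom a)) b" ..
qed

text \<open>Bidegree questions become questions about the monomials in the support.\<close>

lemma mem_Sgr_iff: "f \<in> Sgr d e \<longleftrightarrow> Poly_Mapping.keys f \<subseteq> bimons d e"
proof
  assume "f \<in> Sgr d e"
  then show "Poly_Mapping.keys f \<subseteq> bimons d e"
    unfolding Sgr_def
  proof (induction rule: cpoly.span_induct_alt)
    case (step c x y)
    have "Poly_Mapping.keys (pscale c x + y) \<subseteq> Poly_Mapping.keys x \<union> Poly_Mapping.keys y"
      by (auto simp: in_keys_iff lookup_add)
    with step show ?case by auto
  qed simp
next
  assume "Poly_Mapping.keys f \<subseteq> bimons d e"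
  then have "(\<Sum>a\<in>Poly_Mapping.keys f. pscale (Poly_Mapping.lookup f a) (bimonom a)) \<in> Sgr d e"
    unfolding Sgr_def by (intro cpoly.span_sum cpoly.span_scale cpoly.span_base) auto
  then show "f \<in> Sgr d e"
    using bimonom_expansion[of "Poly_Mapping.keys f" f] by simp
qed

lemma subspace_Sgr: "cpoly.subspace (Sgr d e)"
  by (simp add: Sgr_def cpoly.subspace_span)

lemma bimons_add:
  "a \<in> bimons d e \<Longrightarrow> b \<in> bimons d' e' \<Longrightarrow> a + b \<in> bimons (d + d') (e + e')"
  by (simp add: bimons_def lookup_add sum.distrib)

lemma mult_mem_Sgr:
  assumes "f \<in> Sgr d e" "g \<in> Sgr d' e'"
  shows "f * g \<in> Sgr (d + d') (e + e')"
  using assms keys_mult[of f g] bimons_add unfolding mem_Sgr_iff by fastforce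

lemma bimonom_mult_mem_Sgr:
  "a \<in> bimons d e \<Longrightarrow> f \<in> Sgr d' e' \<Longrightarrow> bimonom a * f \<in> Sgr (d + d') (e + e')"
  by (rule mult_mem_Sgr) (simp_all add: mem_Sgr_iff)

lemma inj_bimonom: "inj bimonom"
  by (auto simp: inj_on_def bimonom_def dest: arg_cong[where f = Poly_Mapping.keys])

lemma independent_bimonoms: "cpoly.independent (bimonom ` X)"
  unfolding cpoly.independent_explicit_module
proof (intro allI impI)
  fix t u v
  assume t: "finite t" "t \<subseteq> bimonom ` X" "(\<Sum>w\<in>t. pscale (u w) w) = 0" "v \<in> t"
  then obtain a where a: "v = bimonom a" by auto
  have "0 = Poly_Mapping.lookup (\<Sum>w\<in>t. pscale (u w) w) a" using t(3) by simp
  also have "\<dots> = (\<Sum>w\<in>t. if w = v then u w else 0)"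
    unfolding lookup_sum
    by (intro sum.cong) (auto simp: a lookup_bimonom dest!: subsetD[OF t(2)] split: if_splits)
  also have "\<dots> = u v" using t by simp
  finally show "u v = 0" ..
qed

text \<open>Links the number of columns demanded by \<open>pre_normal_form\<close> to the number of
  monomials.\<close>

lemma dim_Sgr:
  "cpoly.dim (Sgr d e :: ('m::finite, 'n::finite) bipoly set) =
    card (bimons d e :: ('m, 'n) bimon set)"
  unfolding Sgr_def cpoly.dim_span_eq_card_independent[OF independent_bimonoms]
  by (simp add: card_image inj_on_subset[OF inj_bimonom])

text \<open>The projection onto bidegree \<open>(d, e)\<close>. Summing over the support of
  \<open>f\<close> keeps the sum finite whether or not \<open>bimons d e\<close> is known to be
  finite.\<close>

definition bihom_part :: "nat \<Rightarrow> nat \<Rightarrow> ('m::finite, 'n::finite) bipoly \<Rightarrow> ('m, 'n) bipoly" where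
  "bihom_part d e f =
    (\<Sum>a\<in>Poly_Mapping.keys f \<inter> bimons d e. pscale (Poly_Mapping.lookup f a) (bimonom a))"

lemma lookup_bihom_part:
  "Poly_Mapping.lookup (bihom_part d e f) a =
    (if a \<in> bimons d e then Poly_Mapping.lookup f a else 0)"
proof -
  have "Poly_Mapping.lookup (bihom_part d e f) a =
      (\<Sum>b\<in>Poly_Mapping.keys f \<inter> bimons d e. if b = a then Poly_Mapping.lookup f b else 0)"
    unfolding bihom_part_def lookup_sum by (intro sum.cong) (auto simp: lookup_bimonom)
  then show ?thesis by (auto simp: in_keys_iff)
qed

lemma bihom_part_0 [simp]: "bihom_part d e 0 = 0"
  by (simp add: bihom_part_def)

lemma bihom_part_add: "bihom_part d e (f + g) = bihom_part d e f + bihom_part d e g"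
  by (rule poly_mapping_eqI) (simp add: lookup_bihom_part lookup_add)

lemma bihom_part_pscale: "bihom_part d e (pscale c f) = pscale c (bihom_part d e f)"
  by (rule poly_mapping_eqI) (simp add: lookup_bihom_part)

lemma bihom_part_sum: "bihom_part d e (sum f K) = (\<Sum>k\<in>K. bihom_part d e (f k))"
  by (induction K rule: infinite_finite_induct) (simp_all add: bihom_part_add)

text \<open>Each monomial has exactly one bidegree, so different graded pieces have disjoint
  supports.\<close>

lemma bihom_part_Sgr:
  assumes "f \<in> Sgr d e"
  shows "bihom_part d' e' f = (if d' = d \<and> e' = e then f else 0)"
proof (rule poly_mapping_eqI)
  fix a
  show "Poly_Mapping.lookup (bihom_part d' e' f) a =
      Poly_Mapping.lookup (if d' = d \<and> e' = e then f else 0) a"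
    using assms by (auto simp: lookup_bihom_part mem_Sgr_iff bimons_def in_keys_iff)
qed

text \<open>An ideal element is a combination of products of monomials with generators. Each product
  is bihomogeneous, so projecting to bidegree \<open>(d, e)\<close> keeps it or kills it, and a
  product that is kept has a monomial factor of bidegree \<open>(d - p, e - q)\<close>.\<close>

lemma ideal_gen_Int_Sgr:
  assumes F: "F \<subseteq> Sgr p q" and pq: "p \<le> d" "q \<le> e"
  shows "ideal_gen F \<inter> Sgr d e =
    cpoly.span {bimonom a * f | a f. a \<in> bimons (d - p) (e - q) \<and> f \<in> F}"
    (is "_ = cpoly.span ?G")
proof (intro equalityI subsetI)
  fix f
  assume f: "f \<in> ideal_gen F \<inter> Sgr d e"
  have part: "bihom_part d e (bimonom a * g) \<in> cpoly.span ?G" if g: "g \<in> F" for a g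
  proof -
    define i j where "i = (\<Sum>k\<in>UNIV. Poly_Mapping.lookup a (Inl k))"
      and "j = (\<Sum>l\<in>UNIV. Poly_Mapping.lookup a (Inr l))"
    have a: "a \<in> bimons i j" by (simp add: bimons_def i_def j_def)
    then have "bimonom a * g \<in> Sgr (i + p) (j + q)"
      using g F by (intro bimonom_mult_mem_Sgr) auto
    then have "bihom_part d e (bimonom a * g) = (if d = i + p \<and> e = j + q then bimonom a * g else 0)"
      by (rule bihom_part_Sgr)
    then show ?thesis
      using a g by (auto simp: cpoly.span_zero intro!: cpoly.span_base)
  qed
  have "bihom_part d e f \<in> cpoly.span ?G"
    using f[THEN IntD1]
  proof (induction rule: ring_mult.span_induct_alt)
    case base
    show ?case by (simp add: cpoly.span_zero)
  next
    case (step c x y)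
    \<comment> \<open>The factor \<open>c\<close> is an arbitrary polynomial; it is split into
      monomials so that \<open>part\<close> applies.\<close>
    have "c * x = (\<Sum>a\<in>Poly_Mapping.keys c. pscale (Poly_Mapping.lookup c a) (bimonom a)) * x"
      using bimonom_expansion[of "Poly_Mapping.keys c" c] by simp
    then have "bihom_part d e (c * x) =
        (\<Sum>a\<in>Poly_Mapping.keys c. pscale (Poly_Mapping.lookup c a) (bihom_part d e (bimonom a * x)))"
      by (simp add: sum_distrib_right mult_pscale_left bihom_part_sum bihom_part_pscale)
    also have "\<dots> \<in> cpoly.span ?G"
      using part[OF step(1)] by (intro cpoly.span_sum cpoly.span_scale)
    finally show ?case
      using step(2) by (simp add: bihom_part_add cpoly.span_add)
  qed
  then show "f \<in> cpoly.span ?G"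
    using f bihom_part_Sgr[of f d e d e] by simp
next
  fix f
  assume "f \<in> cpoly.span ?G"
  then show "f \<in> ideal_gen F \<inter> Sgr d e"
  proof (induction rule: cpoly.span_induct_alt)
    case base
    show ?case by (simp add: ring_mult.span_zero mem_Sgr_iff)
  next
    case (step c x y)
    from step(1) obtain a g where x: "x = bimonom a * g" "a \<in> bimons (d - p) (e - q)" "g \<in> F"
      by auto
    \<comment> \<open>By \<open>p \<le> d\<close> and \<open>q \<le> e\<close> the truncated
      differences are exact, so this bidegree is \<open>(d, e)\<close>.\<close>
    have "bimonom a * g \<in> Sgr (d - p + p) (e - q + q)"
      using x F by (intro bimonom_mult_mem_Sgr) auto
    then have "pscale c x + y \<in> Sgr d e"
      using pq step(2) x(1)
      by (simp add: cpoly.subspace_add[OF subspace_Sgr] cpoly.subspace_scale[OF subspace_Sgr])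
    moreover have "pscale c x + y \<in> ideal_gen F"
      using step(2) x by (auto simp: pscale_def intro!: ring_mult.span_add ring_mult.span_scale
          intro: ring_mult.span_base)
    ultimately show ?case by simp
  qed
qed


section \<open>Quotient dimensions and separating functionals\<close>

text \<open>Lifts of a basis of \<open>V / W\<close> are joined to a basis of \<open>W\<close>. In a
  vanishing combination the part over \<open>B\<close> lies in \<open>W\<close>, so its coefficients
  vanish, and independence of \<open>D\<close> handles the rest.\<close>

lemma quot_basis_Un:
  assumes B: "quot_basis V W B" and D: "cpoly.independent D" "cpoly.span D = W"
  shows "B \<inter> D = {}" "cpoly.independent (B \<union> D)" "V \<subseteq> cpoly.span (B \<union> D)"
proof -
  have indep: "\<And>T c b. finite T \<Longrightarrow> T \<subseteq> B \<Longrightarrow> (\<Sum>b\<in>T. pscale (c b) b) \<in> W \<Longrightarrow> b \<in> T \<Longrightarrow> c b = 0"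
    using B unfolding quot_basis_def by blast
  \<comment> \<open>A representative in \<open>W\<close> would give a relation modulo
    \<open>W\<close> with coefficient 1.\<close>
  have "b \<notin> W" if "b \<in> B" for b
    using indep[of "{b}" "\<lambda>_. 1" b] that by auto
  then show disj: "B \<inter> D = {}"
    using D(2) cpoly.span_base by blast
  show "cpoly.independent (B \<union> D)"
    unfolding cpoly.independent_explicit_module
  proof (intro allI impI)
    fix t u v
    assume t: "finite t" "t \<subseteq> B \<union> D" "(\<Sum>w\<in>t. pscale (u w) w) = 0" "v \<in> t"
    have split: "(\<Sum>w\<in>t \<inter> B. pscale (u w) w) + (\<Sum>w\<in>t \<inter> D. pscale (u w) w) = 0"
    proof -
      have "t = (t \<inter> B) \<union> (t \<inter> D)" using t(2) by blast
      then have "(\<Sum>w\<in>t. pscale (u w) w) =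
          (\<Sum>w\<in>t \<inter> B. pscale (u w) w) + (\<Sum>w\<in>t \<inter> D. pscale (u w) w)"
        using t(1) disj by (subst sum.union_disjoint[symmetric]) auto
      then show ?thesis using t(3) by simp
    qed
    have "(\<Sum>w\<in>t \<inter> D. pscale (u w) w) \<in> W"
      unfolding D(2)[symmetric] by (intro cpoly.span_sum cpoly.span_scale cpoly.span_base) auto
    moreover have "(\<Sum>w\<in>t \<inter> B. pscale (u w) w) = - (\<Sum>w\<in>t \<inter> D. pscale (u w) w)"
      using split by (simp add: eq_neg_iff_add_eq_0)
    ultimately have "(\<Sum>w\<in>t \<inter> B. pscale (u w) w) \<in> W"
      unfolding D(2)[symmetric] by (simp add: cpoly.span_neg)
    then have 1: "u w = 0" if "w \<in> t \<inter> B" for w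
      using indep[of "t \<inter> B" u w] t(1) that by auto
    then have "(\<Sum>w\<in>t \<inter> D. pscale (u w) w) = 0"
      using split by simp
    then have "u w = 0" if "w \<in> t \<inter> D" for w
      using cpoly.independentD[OF D(1), of "t \<inter> D" u w] t(1) that by auto
    with 1 show "u v = 0"
      using t by blast
  qed
  show "V \<subseteq> cpoly.span (B \<union> D)"
  proof
    fix v
    assume "v \<in> V"
    then obtain w where w: "w \<in> cpoly.span B" "v - w \<in> cpoly.span D"
      using B D(2) unfolding quot_basis_def by blast
    have "w + (v - w) \<in> cpoly.span (B \<union> D)"
      using w cpoly.span_mono[of B "B \<union> D"] cpoly.span_mono[of D "B \<union> D"]
      by (intro cpoly.span_add) auto
    then show "v \<in> cpoly.span (B \<union> D)" by simp
  qed
qed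

text \<open>\<open>quot_dim\<close> counts a chosen quotient basis. Adding a basis of
  \<open>W\<close> shows that all quotient bases have the same cardinality, so any explicit one may
  be counted. The finite spanning set \<open>G\<close> keeps the sets finite, where
  \<open>card\<close> is meaningful.\<close>

lemma quot_dim_eq_card:
  assumes W: "cpoly.subspace W" "W \<subseteq> V" and V: "finite G" "V \<subseteq> cpoly.span G"
    and B: "quot_basis V W B"
  shows "quot_dim V W = card B"
proof -
  obtain D where D: "D \<subseteq> W" "cpoly.independent D" "W \<subseteq> cpoly.span D"
    using cpoly.maximal_independent_subset[of W] by blast
  then have span_D: "cpoly.span D = W"
    using cpoly.span_minimal[OF D(1) W(1)] by blast
  have card: "card B' = cpoly.dim V - card D" if B': "quot_basis V W B'" for B'
  proof -
    note Un = quot_basis_Un[OF B' D(2) span_D]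
    have sub: "B' \<union> D \<subseteq> V"
      using B' D(1) W(2) by (auto simp: quot_basis_def)
    have "finite (B' \<union> D)"
      using cpoly.independent_span_bound[OF V(1) Un(2)] sub V(2) by blast
    then have "card (B' \<union> D) = card B' + card D"
      using Un(1) by (simp add: card_Un_disjoint)
    moreover have "card (B' \<union> D) = cpoly.dim V"
      using cpoly.basis_card_eq_dim[OF sub Un(3,2)] .
    ultimately show ?thesis by simp
  qed
  \<comment> \<open>\<open>B\<close> witnesses that the choice by \<open>SOME\<close> yields a
    quotient basis.\<close>
  show ?thesis
    unfolding quot_dim_def using card[OF someI[of "quot_basis V W", OF B]] card[OF B] by simp
qed

text \<open>A basis of \<open>W\<close> stays independent when \<open>f\<close> is added. Extend it
  to a basis of the whole ring and take the coordinate along \<open>f\<close>.\<close>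

lemma separating_functional:
  assumes W: "cpoly.subspace W" and f: "f \<notin> W"
  obtains \<phi> where "Vector_Spaces.linear pscale (*) \<phi>" "\<phi> f = 1" "\<And>g. g \<in> W \<Longrightarrow> \<phi> g = 0"
proof -
  obtain D where D: "D \<subseteq> W" "cpoly.independent D" "W \<subseteq> cpoly.span D"
    using cpoly.maximal_independent_subset[of W] by blast
  then have span_D: "cpoly.span D = W"
    using cpoly.span_minimal[OF D(1) W] by blast
  have "f \<notin> D" using D(1) f by blast
  have ind: "cpoly.independent (insert f D)"
    using D(2) f span_D by (simp add: cpoly.independent_insert)
  define E where "E = cpoly.extend_basis (insert f D)"
  have E: "cpoly.independent E" "cpoly.span E = UNIV" "insert f D \<subseteq> E"
    unfolding E_def using cpoly.independent_extend_basis[OF ind] cpoly.span_extend_basis[OF ind]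
      cpoly.extend_basis_superset[OF ind] by auto
  define \<phi> where "\<phi> = (\<lambda>g. cpoly.representation E g f)"
  have lin: "Vector_Spaces.linear pscale (*) \<phi>"
    unfolding \<phi>_def by (rule cpoly.linear_representation[OF E(1,2)])
  interpret \<phi>: Vector_Spaces.linear pscale "(*)" \<phi> by (rule lin)
  show thesis
  proof
    show "\<phi> f = 1"
      using E by (simp add: \<phi>_def cpoly.representation_basis)
    show "\<phi> g = 0" if "g \<in> W" for g
      using that unfolding span_D[symmetric]
    proof (induction rule: cpoly.span_induct_alt)
      case (step c x y)
      \<comment> \<open>Elements of \<open>D\<close> are basis vectors other than \<open>f\<close>,
        so their coordinate along \<open>f\<close> is 0.\<close>
      then have "\<phi> x = 0"
        using E \<open>f \<notin> D\<close> by (auto simp: \<phi>_def cpoly.representation_basis)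
      then show ?case
        using step by (simp add: \<phi>.add \<phi>.scale)
    qed (simp add: \<phi>.zero)
  qed (rule lin)
qed


section \<open>Matrices\<close>

text \<open>The Gram matrix \<open>N N\<^sup>*\<close> is invertible when the rows of \<open>N\<close> are independent.\<close>

lemma right_inverse_exists:
  fixes N :: "complex mat"
  assumes N: "N \<in> carrier_mat k n"
    and inj: "\<And>x. x \<in> carrier_vec k \<Longrightarrow> transpose_mat N *\<^sub>v x = 0\<^sub>v n \<Longrightarrow> x = 0\<^sub>v k"
  obtains X where "X \<in> carrier_mat n k" "N * X = 1\<^sub>m k"
proof -
  \<comment> \<open>\<open>H\<close> is the conjugate transpose of \<open>N\<close>, so
    \<open>G\<close> is the Gram matrix of the rows.\<close>
  define H where "H = Matrix.mat n k (\<lambda>(i, j). cnj (N $$ (j, i)))"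
  have H: "H \<in> carrier_mat n k" by (simp add: H_def)
  define G where "G = N * H"
  have G: "G \<in> carrier_mat k k" using N H by (simp add: G_def)
  have "x = 0\<^sub>v k" if x: "x \<in> carrier_vec k" "G *\<^sub>v x = 0\<^sub>v k" for x
  proof -
    define y where "y = H *\<^sub>v x"
    have y: "y \<in> carrier_vec n" using H x by (simp add: y_def)
    have conj_y: "conjugate y = transpose_mat N *\<^sub>v conjugate x"
      using N x(1) by (intro eq_vecI) (auto simp: y_def H_def scalar_prod_def)
    have Ny: "N *\<^sub>v y = 0\<^sub>v k"
      using x N H by (simp add: y_def G_def)
    \<comment> \<open>The Hermitian norm of \<open>y = H x\<close> is the pairing of
      \<open>conjugate x\<close> with \<open>N y = G x = 0\<close>.\<close>
    have "y \<bullet>c y = (transpose_mat N *\<^sub>v conjugate x) \<bullet> y"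
      using y unfolding conj_y[symmetric] by (intro comm_scalar_prod[of _ n]) auto
    also have "\<dots> = conjugate x \<bullet> (N *\<^sub>v y)"
      using N x(1) y by (simp add: transpose_vec_mult_scalar)
    also have "\<dots> = 0" using x(1) by (simp add: Ny)
    finally have "y = 0\<^sub>v n" using y by simp
    then have "transpose_mat N *\<^sub>v conjugate x = 0\<^sub>v n"
      by (simp add: conj_y[symmetric])
    then have "conjugate x = 0\<^sub>v k" using inj[OF carrier_vec_conjugate[OF x(1)]] by blast
    then show ?thesis using x(1) by simp
  qed
  then have "det G \<noteq> 0"
    using det_0_iff_vec_prod_zero_field[OF G] by blast
  then obtain J where J: "J \<in> carrier_mat k k" "G * J = 1\<^sub>m k"
    using det_non_zero_imp_unit[OF G, of undefined] by (auto simp: Units_def ring_mat_def)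
  show thesis
  proof
    show "H * J \<in> carrier_mat n k" using H J by simp
    show "N * (H * J) = 1\<^sub>m k"
      using J N H by (simp add: G_def assoc_mult_mat[of N k n H k J k])
  qed
qed

text \<open>Each \<open>y\<close> equals \<open>N (X y)\<close>, so the columns span the whole
  space.\<close>

lemma rank_right_invertible:
  fixes N :: "complex mat"
  assumes N: "N \<in> carrier_mat k n" and X: "X \<in> carrier_mat n k" "N * X = 1\<^sub>m k"
  shows "vec_space.rank k N = k"
proof -
  interpret vec_space "TYPE(complex)" k .
  have "y \<in> col_space N" if "y \<in> carrier_vec k" for y
  proof -
    have "N *\<^sub>v (X *\<^sub>v y) = y"
      using N X that by (simp flip: assoc_mult_mat_vec)
    then show ?thesis
      using N X that by (auto simp: col_space_eq[OF N] intro!: bexI[of _ "X *\<^sub>v y"])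
  qed
  then have span: "span (set (cols N)) = carrier_vec k"
    using N unfolding col_space_eq[OF N] col_space_def[symmetric] by auto
  have V: "vs (carrier_vec k) = V"
    by (simp add: module_vec_def)
  show ?thesis
    unfolding rank_def span V by (rule dim_is_n)
qed

section \<open>Coefficient vectors and the left null space of the resultant matrix\<close>

lemma coeff_vec_carrier [simp]: "coeff_vec ms f \<in> carrier_vec (length ms)"
  by (rule carrier_vecI) (simp add: coeff_vec_def)

lemma dim_coeff_vec [simp]: "dim_vec (coeff_vec ms f) = length ms"
  by (simp add: coeff_vec_def)

lemma coeff_vec_index [simp]:
  "i < length ms \<Longrightarrow> coeff_vec ms f $v i = Poly_Mapping.lookup f (ms ! i)"
  by (simp add: coeff_vec_def vec_of_list_index)

lemma coeff_vec_0 [simp]: "coeff_vec ms 0 = 0\<^sub>v (length ms)"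
  by (intro eq_vecI) auto

lemma coeff_vec_add: "coeff_vec ms (f + g) = coeff_vec ms f + coeff_vec ms g"
  by (intro eq_vecI) (auto simp: lookup_add)

lemma coeff_vec_pscale: "coeff_vec ms (pscale c f) = c \<cdot>\<^sub>v coeff_vec ms f"
  by (intro eq_vecI) auto

text \<open>When \<open>ms'\<close> lists the monomials of bidegree \<open>(d - 1, e - 1)\<close>,
  these are the coordinates of the spanning set in \<open>ideal_gen_Int_Sgr\<close> with
  \<open>p = q = 1\<close>.\<close>

lemma set_cols_R_matrix:
  "set (cols (R_matrix ms ms' fs)) =
    coeff_vec ms ` {bimonom a * f | a f. a \<in> set ms' \<and> f \<in> set fs}"
proof -
  have "set (cols (R_matrix ms ms' fs)) =
      set [coeff_vec ms (bimonom a * f). f \<leftarrow> fs, a \<leftarrow> ms']"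
    unfolding R_matrix_def by (subst cols_mat_of_cols) auto
  then show ?thesis by auto
qed

lemma R_matrix_carrier:
  "R_matrix ms ms' fs \<in> carrier_mat (length ms) (dim_col (R_matrix ms ms' fs))"
  by (simp add: R_matrix_def)

text \<open>Entry \<open>j\<close> of the transposed product pairs \<open>w\<close> with column
  \<open>j\<close>. Left null vectors are thus functionals in monomial coordinates that vanish on
  the generators of the graded piece.\<close>

lemma mem_left_kernel_R_matrix_iff:
  "w \<in> mat_kernel (transpose_mat (R_matrix ms ms' fs)) \<longleftrightarrow>
    w \<in> carrier_vec (length ms) \<and>
    (\<forall>a\<in>set ms'. \<forall>f\<in>set fs. w \<bullet> coeff_vec ms (bimonom a * f) = 0)" (is "_ \<longleftrightarrow> _ \<and> ?P")
proof (cases "w \<in> carrier_vec (length ms)")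
  case True
  define R where "R = R_matrix ms ms' fs"
  have R: "R \<in> carrier_mat (length ms) (dim_col R)"
    by (simp add: R_def R_matrix_carrier)
  have "w \<in> mat_kernel (transpose_mat R) \<longleftrightarrow> (\<forall>j<dim_col R. col R j \<bullet> w = 0)"
  proof -
    have Rt: "transpose_mat R \<in> carrier_mat (dim_col R) (length ms)"
      using R by (rule transpose_carrier_mat[THEN iffD2])
    have "w \<in> mat_kernel (transpose_mat R) \<longleftrightarrow> transpose_mat R *\<^sub>v w = 0\<^sub>v (dim_col R)"
      unfolding mat_kernel[OF Rt] using True by blast
    also have "\<dots> \<longleftrightarrow> (\<forall>j<dim_col R. col R j \<bullet> w = 0)"
      unfolding Matrix.vec_eq_iff by simp
    finally show ?thesis .
  qed
  also have "\<dots> \<longleftrightarrow> (\<forall>v\<in>set (cols R). v \<bullet> w = 0)"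
    unfolding cols_def by auto
  also have "\<dots> \<longleftrightarrow> ?P"
    unfolding R_def set_cols_R_matrix
    using comm_scalar_prod[OF True coeff_vec_carrier] by fastforce
  finally show ?thesis
    using True unfolding R_def by blast
next
  case False
  moreover have "mat_kernel (transpose_mat (R_matrix ms ms' fs)) \<subseteq> carrier_vec (length ms)"
    by (rule mat_kernel_carrier[OF transpose_carrier_mat[THEN iffD2, OF R_matrix_carrier]])
  ultimately show ?thesis by blast
qed

text \<open>The rows span the left null space, so a vector orthogonal to all rows is orthogonal to
  that whole space. Independence of the rows means that the transpose of \<open>N\<close> has
  trivial kernel.\<close>

lemma left_nullspace_matrixD:
  assumes N: "left_nullspace_matrix N M"
  shows "N \<in> carrier_mat (dim_row N) (dim_row M)"
    and "i < dim_row N \<Longrightarrow> Matrix.row N i \<in> mat_kernel (transpose_mat M)"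
    and "w \<in> mat_kernel (transpose_mat M) \<Longrightarrow> v \<in> carrier_vec (dim_row M) \<Longrightarrow>
      N *\<^sub>v v = 0\<^sub>v (dim_row N) \<Longrightarrow> w \<bullet> v = 0"
    and "x \<in> carrier_vec (dim_row N) \<Longrightarrow> transpose_mat N *\<^sub>v x = 0\<^sub>v (dim_row M) \<Longrightarrow>
      x = 0\<^sub>v (dim_row N)"
proof -
  let ?n = "dim_row M" and ?k = "dim_row N" and ?L = "mat_kernel (transpose_mat M)"
  show N_carrier: "N \<in> carrier_mat ?k ?n"
    using N by (auto simp: left_nullspace_matrix_def)
  interpret kernel "dim_col M" ?n "transpose_mat M"
    by unfold_locales simp
  have rows_N: "set (rows N) \<subseteq> carrier_vec ?n"
    using rows_carrier[of N] N_carrier by (metis carrier_matD(2))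
  have "basis (set (rows N))"
    using N by (simp add: left_nullspace_matrix_def)
  then have rows: "set (rows N) \<subseteq> ?L" "lin_indpt (set (rows N))" "span (set (rows N)) = ?L"
    by (auto simp: Ker.basis_def)
  \<comment> \<open>Span and independence move from the null space \<open>Ker\<close> to the ambient
    space \<open>NC\<close>, where orthogonal complements are taken.\<close>
  have span: "NC.span (set (rows N)) = ?L" and indpt: "NC.lin_indpt (set (rows N))"
    using rows span_same lindep_same by auto
  show "Matrix.row N i \<in> ?L" if "i < ?k"
    using rows(1) that by (auto simp: rows_def)
  show "w \<bullet> v = 0" if w: "w \<in> ?L" and v: "v \<in> carrier_vec ?n" "N *\<^sub>v v = 0\<^sub>v ?k"
  proof -
    have "v \<bullet> y = 0" if "y \<in> set (rows N)" for y
    proof -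
      obtain i where i: "i < ?k" "y = Matrix.row N i"
        using \<open>y \<in> set (rows N)\<close> by (auto simp: rows_def)
      have "Matrix.row N i \<in> carrier_vec ?n"
        using row_carrier[of N i] N_carrier by (metis carrier_matD(2))
      then have "v \<bullet> y = (N *\<^sub>v v) $v i"
        unfolding i(2) index_mult_mat_vec[OF i(1)] by (rule comm_scalar_prod[OF v(1)])
      also have "\<dots> = 0"
        unfolding v(2) by (rule index_zero_vec(1)[OF i(1)])
      finally show ?thesis .
    qed
    then have "v \<in> NC.orthogonal_complement (set (rows N))"
      unfolding NC.orthogonal_complement_def using v(1) by blast
    also have "NC.orthogonal_complement (set (rows N)) = NC.orthogonal_complement ?L"
      unfolding span[symmetric] by (rule NC.in_orthogonal_complement_span[OF rows_N, symmetric])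
    finally have "v \<bullet> w = 0"
      unfolding NC.orthogonal_complement_def using w by blast
    moreover have "w \<in> carrier_vec ?n"
      by (rule mat_kernelD(1)[OF A w])
    ultimately show ?thesis
      using comm_scalar_prod[OF _ v(1)] by metis
  qed
  show "x = 0\<^sub>v ?k" if x: "x \<in> carrier_vec ?k" "transpose_mat N *\<^sub>v x = 0\<^sub>v ?n"
  proof (rule ccontr)
    assume "x \<noteq> 0\<^sub>v ?k"
    \<comment> \<open>As no row is repeated, a nontrivial relation in the list of rows is a
      dependence of the set of rows.\<close>
    moreover have "distinct (cols (transpose_mat N))"
      using N by (simp add: left_nullspace_matrix_def)
    ultimately have "NC.lin_dep (set (cols (transpose_mat N)))"
      using NC.lin_depI[OF transpose_carrier_mat[THEN iffD2, OF N_carrier] x(1) _ x(2)] by blast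
    then show False using indpt by simp
  qed
qed

theorem proposition3p1:
  fixes A :: "('l::finite, 'm::finite, 'n::finite) tensor"
    and \<alpha> :: "nat \<Rightarrow> complex ^ 'l"
    and \<beta> :: "nat \<Rightarrow> complex ^ 'm"
    and \<gamma> :: "nat \<Rightarrow> complex ^ 'n"
    and l m n r d e :: nat
    and fs :: "('m, 'n) bipoly list"
    and I :: "('m, 'n) bipoly set"
    and ms ms' :: "('m, 'n) bimon list"
    and N :: "complex mat"
  assumes dims: "CARD('l) = l + 1" "CARD('m) = m + 1" "CARD('n) = n + 1"
    and lmn: "l \<ge> m" "m \<ge> n" "n > 0"
    and decomposition: "A = (\<Sum>i<r. tprod (\<alpha> i) (\<beta> i) (\<gamma> i))"
    and A_rank: "tensor_rank A = r"
    and r_le: "r \<le> min (l + 1) (m * n)"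
    and ident: "identifiable r A"
    and flat_rank: "rank (flattening A) = r"
    and fs_basis: "distinct fs" "cpoly.independent (set fs)"
      "cpoly.span (set fs) = ker_flattening A"
    and I: "I = ideal_gen (set fs)"
    and zeros: "zero_set I = (\<lambda>i. (proj_point (\<beta> i), proj_point (\<gamma> i))) ` {..<r}"
    and zeros_card: "card (zero_set I) = r"
    and zeros_reduced: "\<forall>P\<in>zero_set I. reduced_ring (local_ring I P)"
    and de: "d \<ge> 1" "e \<ge> 1"
    and HF: "HF_quot I d e = r"
    and monomials: "enumerates ms d e" "enumerates ms' (d - 1) (e - 1)"
    and N: "left_nullspace_matrix N (R_matrix ms ms' fs)"
  shows "pre_normal_form ms I d e r N"
proof -
  \<comment> \<open>By \<open>I_U\<close> below, \<open>U\<close> is the piece of \<open>I\<close>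
    of bidegree \<open>(d, e)\<close>; its generators give the columns of \<open>R\<close>.\<close>
  define U where "U = cpoly.span {bimonom a * f | a f. a \<in> bimons (d - 1) (e - 1) \<and> f \<in> set fs}"
  define k where "k = dim_row N"
  define R where "R = R_matrix ms ms' fs"
  have ms: "distinct ms" "set ms = bimons d e" and ms': "set ms' = bimons (d - 1) (e - 1)"
    using monomials by (auto simp: enumerates_def)
  have fin: "finite (bimons d e :: ('m, 'n) bimon set)"
    using ms by (metis List.finite_set)
  have dim: "cpoly.dim (Sgr d e :: ('m, 'n) bipoly set) = length ms"
    using ms by (metis dim_Sgr distinct_card)
  have "set fs \<subseteq> Sgr 1 1"
    using fs_basis(3) cpoly.span_superset[of "set fs"] by (auto simp: ker_flattening_def)
  then have I_U: "I \<inter> Sgr d e = U"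
    unfolding I U_def using de by (intro ideal_gen_Int_Sgr)
  have U: "cpoly.subspace U" "U \<subseteq> Sgr d e"
    using I_U by (auto simp: U_def)
  have R: "dim_row R = length ms"
    by (simp add: R_def R_matrix_def)
  note ND = left_nullspace_matrixD[OF N, folded R_def, unfolded R, folded k_def]
  note left_ker = mem_left_kernel_R_matrix_iff[of _ ms ms' fs, folded R_def, unfolded ms']

  \<comment> \<open>The kernel of \<open>N\<close> as a double annihilator\<close>
  have ker: "{f \<in> Sgr d e. N *\<^sub>v coeff_vec ms f = 0\<^sub>v k} = U"
  proof (intro equalityI subsetI)
    fix f
    assume "f \<in> {f \<in> Sgr d e. N *\<^sub>v coeff_vec ms f = 0\<^sub>v k}"
    then have f: "f \<in> Sgr d e" "N *\<^sub>v coeff_vec ms f = 0\<^sub>v k" by auto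
    show "f \<in> U"
    proof (rule ccontr)
      \<comment> \<open>A functional that kills \<open>U\<close> but not \<open>f\<close> is, in
        coordinates, a left null vector \<open>w\<close>. The rows of \<open>N\<close> annihilate
        \<open>f\<close>, hence so does \<open>w\<close>, contradicting
        \<open>\<phi> f = 1\<close>.\<close>
      assume "f \<notin> U"
      then obtain \<phi> where \<phi>: "Vector_Spaces.linear pscale (*) \<phi>" "\<phi> f = 1"
          "\<And>g. g \<in> U \<Longrightarrow> \<phi> g = 0"
        using separating_functional[OF U(1)] by blast
      interpret \<phi>: Vector_Spaces.linear pscale "(*)" \<phi> by (rule \<phi>(1))
      \<comment> \<open>The values of \<open>\<phi>\<close> on the monomials are its coordinates in
        the dual basis.\<close>
      define w where "w = Matrix.vec (length ms) (\<lambda>j. \<phi> (bimonom (ms ! j)))"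
      have w_apply: "w \<bullet> coeff_vec ms g = \<phi> g" if "g \<in> Sgr d e" for g
      proof -
        have "g = (\<Sum>a\<in>set ms. pscale (Poly_Mapping.lookup g a) (bimonom a))"
          using that ms fin by (intro bimonom_expansion) (auto simp: mem_Sgr_iff)
        then have "\<phi> g = \<phi> (\<Sum>a\<in>set ms. pscale (Poly_Mapping.lookup g a) (bimonom a))" by simp
        also have "\<dots> = (\<Sum>a\<in>set ms. Poly_Mapping.lookup g a * \<phi> (bimonom a))"
          by (simp add: \<phi>.sum \<phi>.scale)
        also have "\<dots> = (\<Sum>j<length ms. Poly_Mapping.lookup g (ms ! j) * \<phi> (bimonom (ms ! j)))"
          using ms(1) by (intro sum.reindex_bij_betw[symmetric] bij_betw_nth) auto
        also have "\<dots> = w \<bullet> coeff_vec ms g"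
          by (auto simp: scalar_prod_def w_def atLeast0LessThan mult.commute intro!: sum.cong)
        finally show ?thesis ..
      qed
      have "w \<in> mat_kernel (transpose_mat R)"
        unfolding left_ker
      proof (intro conjI ballI)
        fix a :: "('m, 'n) bimon" and h :: "('m, 'n) bipoly"
        assume "a \<in> bimons (d - 1) (e - 1)" "h \<in> set fs"
        then have "bimonom a * h \<in> U"
          unfolding U_def by (intro cpoly.span_base) auto
        then show "w \<bullet> coeff_vec ms (bimonom a * h) = 0"
          using w_apply \<phi>(3) U(2) by auto
      qed (simp add: w_def)
      then have "w \<bullet> coeff_vec ms f = 0"
        using ND(3) f(2) by simp
      with w_apply[OF f(1)] \<phi>(2) show False by simp
    qed
  next
    fix f
    assume f: "f \<in> U"
    then have "N *\<^sub>v coeff_vec ms f = 0\<^sub>v k"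
      unfolding U_def
    proof (induction rule: cpoly.span_induct_alt)
      case base
      show ?case using ND(1) by auto
    next
      case (step c x y)
      \<comment> \<open>Every row of \<open>N\<close> is a left null vector, so it kills the
        generator \<open>x\<close>.\<close>
      have "N *\<^sub>v coeff_vec ms x = 0\<^sub>v k"
        using step(1) ND(1,2) by (intro eq_vecI) (auto simp: left_ker)
      moreover have "c \<cdot>\<^sub>v 0\<^sub>v k = (0\<^sub>v k :: complex Matrix.vec)"
        by (intro eq_vecI) auto
      ultimately show ?case
        using step(2) ND(1) by (simp add: coeff_vec_add coeff_vec_pscale
            mult_add_distrib_mat_vec[of N k "length ms"] mult_mat_vec[of N k "length ms"])
    qed
    with f U(2) show "f \<in> {f \<in> Sgr d e. N *\<^sub>v coeff_vec ms f = 0\<^sub>v k}" by auto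
  qed

  \<comment> \<open>Surjectivity of \<open>N\<close> and the number of its rows\<close>
  obtain X where X: "X \<in> carrier_mat (length ms) k" "N * X = 1\<^sub>m k"
    using right_inverse_exists[OF ND(1,4)] by blast

  \<comment> \<open>Column \<open>i\<close> of \<open>X\<close> read as a polynomial. For
    \<open>i < k\<close>, \<open>N\<close> sends \<open>p i\<close> to the unit vector
    \<open>i\<close>; these lifts will represent a basis of the quotient by
    \<open>U\<close>.\<close>
  define p where "p i = (\<Sum>j<length ms. pscale (X $$ (j, i)) (bimonom (ms ! j)))" for i
  have p_Sgr: "p i \<in> Sgr d e" for i
    unfolding p_def Sgr_def using ms(2)
    by (intro cpoly.span_sum cpoly.span_scale cpoly.span_base) (auto intro: nth_mem)
  have coeff_p: "coeff_vec ms (p i) = col X i" if "i < k" for i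
  proof (intro eq_vecI)
    fix j
    assume j: "j < dim_vec (col X i)"
    then have j: "j < length ms" using X by simp
    have "coeff_vec ms (p i) $v j = Poly_Mapping.lookup (p i) (ms ! j)"
      using j by simp
    also have "\<dots> = (\<Sum>t<length ms. if t = j then X $$ (t, i) else 0)"
      unfolding p_def lookup_sum using j ms(1)
      by (intro sum.cong) (auto simp: lookup_bimonom nth_eq_iff_index_eq)
    also have "\<dots> = col X i $v j" using j X that by simp
    finally show "coeff_vec ms (p i) $v j = col X i $v j" .
  qed (use X in auto)
  \<comment> \<open>A general \<open>K\<close> serves both clauses of \<open>quot_basis\<close>:
    subsets for independence, \<open>{..<k}\<close> for spanning.\<close>
  have N_comb: "(N *\<^sub>v coeff_vec ms (\<Sum>i\<in>K. pscale (c i) (p i))) $v t =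
      (if t \<in> K then c t else 0)" if K: "K \<subseteq> {..<k}" and t: "t < k" for K c t
  proof -
    have "finite K" using K finite_subset by blast
    then show ?thesis
      using K
    proof (induction K)
      case empty
      then show ?case using ND(1) t by simp
    next
      case (insert i K)
      have "(N *\<^sub>v col X i) $v t = (N * X) $$ (t, i)"
        using insert.prems ND(1) X(1) t by simp
      also have "\<dots> = (if t = i then 1 else 0)"
        using insert.prems t by (simp add: X(2))
      finally have "(N *\<^sub>v coeff_vec ms (p i)) $v t = (if t = i then 1 else 0)"
        using coeff_p insert.prems by simp
      moreover have "(N *\<^sub>v coeff_vec ms (\<Sum>i\<in>insert i K. pscale (c i) (p i))) =
          c i \<cdot>\<^sub>v (N *\<^sub>v coeff_vec ms (p i)) +
          N *\<^sub>v coeff_vec ms (\<Sum>i\<in>K. pscale (c i) (p i))"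
        using insert.hyps ND(1) by (simp add: coeff_vec_add coeff_vec_pscale
            mult_add_distrib_mat_vec[of N k "length ms"] mult_mat_vec[of N k "length ms"])
      ultimately show ?case
        using insert t ND(1) by auto
    qed
  qed
  have inj_p: "inj_on p {..<k}"
  proof (rule inj_onI)
    fix i j
    assume ij: "i \<in> {..<k}" "j \<in> {..<k}" "p i = p j"
    \<comment> \<open>Entry \<open>i\<close> of the image is 1 for \<open>p i\<close>, but 0 for
      \<open>p j\<close> unless \<open>i = j\<close>.\<close>
    then show "i = j"
      using N_comb[of "{i}" i "\<lambda>_. 1"] N_comb[of "{j}" i "\<lambda>_. 1"] by (auto split: if_splits)
  qed
  have "quot_basis (Sgr d e) U (p ` {..<k})"
    unfolding quot_basis_def
  proof (intro conjI allI impI ballI)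
    show "p ` {..<k} \<subseteq> Sgr d e" using p_Sgr by auto
  next
    fix T c b
    assume T: "finite T \<and> T \<subseteq> p ` {..<k} \<and> (\<Sum>b\<in>T. pscale (c b) b) \<in> U" and b: "b \<in> T"
    from T obtain K where K: "K \<subseteq> {..<k}" "T = p ` K" by (auto simp: subset_image_iff)
    with b obtain t where t: "t \<in> K" "b = p t" by auto
    have "(\<Sum>b\<in>T. pscale (c b) b) = (\<Sum>i\<in>K. pscale (c (p i)) (p i))"
      using inj_on_subset[OF inj_p K(1)] by (simp add: K(2) sum.reindex)
    \<comment> \<open>A combination in \<open>U\<close> is killed by \<open>N\<close>, while the
      entries of its image at \<open>K\<close> are its coefficients.\<close>
    then have "N *\<^sub>v coeff_vec ms (\<Sum>i\<in>K. pscale (c (p i)) (p i)) = 0\<^sub>v k"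
      using T unfolding ker[symmetric] by auto
    with N_comb[OF K(1), of t "\<lambda>i. c (p i)"] t K(1) show "c b = 0" by auto
  next
    fix v :: "('m, 'n) bipoly"
    assume v: "v \<in> Sgr d e"
    \<comment> \<open>The entries of the image of \<open>v\<close> are the coefficients of
      \<open>u\<close>. Then \<open>u\<close> and \<open>v\<close> have the same image, and
      \<open>v - u\<close> lies in the kernel \<open>U\<close>.\<close>
    define c where "c = (\<lambda>i. (N *\<^sub>v coeff_vec ms v) $v i)"
    define u where "u = (\<Sum>i<k. pscale (c i) (p i))"
    have u: "u \<in> cpoly.span (p ` {..<k})"
      unfolding u_def by (intro cpoly.span_sum cpoly.span_scale cpoly.span_base) auto
    have "u \<in> Sgr d e"
      using u cpoly.span_minimal[OF _ subspace_Sgr] p_Sgr by blast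
    moreover have Nu: "N *\<^sub>v coeff_vec ms u = N *\<^sub>v coeff_vec ms v"
      using ND(1) N_comb[of "{..<k}" _ c] by (intro eq_vecI) (auto simp: u_def c_def)
    have "N *\<^sub>v coeff_vec ms (v - u) = 0\<^sub>v k"
    proof -
      have "coeff_vec ms (v - u) = coeff_vec ms v - coeff_vec ms u"
        by (intro eq_vecI) (auto simp: lookup_minus)
      then show ?thesis
        using ND(1) by (simp add: mult_minus_distrib_mat_vec[of N k "length ms"] Nu)
    qed
    ultimately have "v - u \<in> U"
      using v unfolding ker[symmetric] by (simp add: cpoly.subspace_diff[OF subspace_Sgr])
    with u show "\<exists>u\<in>cpoly.span (p ` {..<k}). v - u \<in> U" by blast
  qed
  then have "quot_dim (Sgr d e) U = card (p ` {..<k})"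
    using U fin by (intro quot_dim_eq_card[of _ _ "bimonom ` bimons d e"]) (auto simp: Sgr_def)
  \<comment> \<open>The Hilbert function enters here: the quotient has dimension \<open>k\<close>,
    which \<open>HF\<close> equates with \<open>r\<close>.\<close>
  then have k: "k = r"
    using HF inj_p by (simp add: HF_quot_def I_U card_image)
  show ?thesis
    unfolding pre_normal_form_def
    using ND(1) rank_right_invertible[OF ND(1) X] ker I_U dim by (simp add: k)
qed

end
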